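(* Let $(\mathfrak h,\nabla)$ be a flat Lie algebra. Every Lagrangian symplectic extension $(\mathfrak g,\omega,\mathfrak a)$ over $(\mathfrak h,\nabla)$ gives rise to a (well-defined) characteristic extension class $$[\alpha_{\mathfrak g,\omega,\mathfrak a}]\in H^2_{L,\nabla}(\mathfrak h,\mathfrak h^* ).$$ Two Lagrangian symplectic extensions $(\mathfrak g,\omega,\mathfrak a)$ and $(\mathfrak g',\omega',\mathfrak a')$ over $(\mathfrak h,\nabla)$ are isomorphic (as Lagrangian extensions over $\mathfrak h$) if and only if they have the same extension class in $H^2_{L,\nabla}(\mathfrak h,\mathfrak h^* )$.
   Context: All Lie algebras are finite-dimensional over a fixed field $k$ of characteristic $0$. A symplectic Lie algebra $(\mathfrak g,\omega)$ is a Lie algebra with a non-degenerate alternating form $\omega$ satisfying $\omega([u,v],w)+\omega([w,u],v)+\omega([v,w],u)=0$. A subspace is Lagrangian if it equals its $\omega$-orthogonal. A flat Lie algebra $(\mathfrak h,\nabla)$ is a Lie algebra with a bilinear map $\nabla:\mathfrak h\times\mathfrak h\to\mathfrak h$, $(u,v)\mapsto\nabla_uv$, with $\nabla_uv-\nabla_vu=[u,v]$ and $\nabla_u\nabla_v-\nabla_v\nabla_u=\nabla_{[u,v]}$. Let $\rho:\mathfrak h\to\mathrm{End}(\mathfrak h^* )$, $\rho(u)\xi=-\xi\circ\nabla_u$. Lagrangian extension cohomology: $\mathcal C^1_L(\mathfrak h,\mathfrak h^* )=\{\varphi\in\mathrm{Hom}(\mathfrak h,\mathfrak h^* ):\varphi(u)(v)=\varphi(v)(u)\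 \forall u,v\}$. For $\varphi\in\mathrm{Hom}(\mathfrak h,\mathfrak h^* )$ put $(\partial_\nabla\varphi)(u,v)=\rho(u)\varphi(v)-\rho(v)\varphi(u)-\varphi([u,v])$. $Z^2_{L,\nabla}(\mathfrak h,\mathfrak h^* )$ is the space of those Chevalley–Eilenberg two-cocycles $\alpha\in\mathrm{Hom}(\bigwedge^2\mathfrak h,\mathfrak h^* )$ with respect to $\rho$ which satisfy $\alpha(u,v)(w)+\alpha(w,u)(v)+\alpha(v,w)(u)=0$ for all $u,v,w$. One has $\partial_\nabla\mathcal C^1_L(\mathfrak h,\mathfrak h^* )\subseteq Z^2_{L,\nabla}(\mathfrak h,\mathfrak h^* )$, and $H^2_{L,\nabla}(\mathfrak h,\mathfrak h^* )=Z^2_{L,\nabla}(\mathfrak h,\mathfrak h^* )/\partial_\nabla\mathcal C^1_L(\mathfrak h,\mathfrak h^* )$. A Lagrangian symplectic extension $(\mathfrak g,\omega,\mathfrak a)$ over a Lie algebra $\mathfrak h$ is a symplectic Lie algebra $(\mathfrak g,\omega)$ with a Lie algebra extension $0\to\mathfrak a\to\mathfrak g\to\mathfrak h\to0$ such that the image of $\mathfrak a$ is a Lagrangian ideal of $(\mathfrak g,\omega)$. It induces a flat torsion-free connection on $\mathfrak h$, determined by $\omega(\widetilde{\nabla_uv},a)=-\omega(\tilde v,[\tilde u,a])$ for $u,v\in\mathfrak h$, $a\in\mathfrak a$, where tildes denote arbitrary lifts to $\mathfrak g$. It is an extension over the flat Lie algebra $(\mathfrak h,\nabla)$ if this induced connection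 is the given $\nabla$. An isomorphism of Lagrangian extensions over $\mathfrak h$ is a Lie algebra isomorphism $\Phi:\mathfrak g\to\mathfrak g'$ with $\Phi^*\omega'=\omega$, $\Phi(\mathfrak a)=\mathfrak a'$, inducing the identity on $\mathfrak h$. Extension class: choose a Lagrangian subspace $N$ with $\mathfrak g=\mathfrak a\oplus N$, let $\pi_{\mathfrak a}$ be the projection to $\mathfrak a$ along $N$ and $\tilde u\in N$ the lift of $u\in\mathfrak h$. Then $\alpha_{\mathfrak g,\omega,\mathfrak a,N}(u,v)(w)=\omega(\pi_{\mathfrak a}([\tilde u,\tilde v]),\tilde w)$ defines an element of $Z^2_{L,\nabla}(\mathfrak h,\mathfrak h^* )$, and $[\alpha_{\mathfrak g,\omega,\mathfrak a}]$ denotes its class in $H^2_{L,\nabla}(\mathfrak h,\mathfrak h^* )$; well-definedness means that this class does not depend on the choice of $N$. *)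

theory Defs
  imports Complex_Main "HOL-Library.Function_Algebras"
begin

section \<open>Lie algebras\<close>

definition bilinear_map ::
  "('k::field \<Rightarrow> 'a \<Rightarrow> 'a) \<Rightarrow> ('k \<Rightarrow> 'b \<Rightarrow> 'b) \<Rightarrow> ('k \<Rightarrow> 'c \<Rightarrow> 'c)
    \<Rightarrow> ('a::ab_group_add \<Rightarrow> 'b::ab_group_add \<Rightarrow> 'c::ab_group_add) \<Rightarrow> bool" where
  "bilinear_map s1 s2 s3 f \<longleftrightarrow>
     (\<forall>x. Vector_Spaces.linear s2 s3 (f x)) \<and>
     (\<forall>y. Vector_Spaces.linear s1 s3 (\<lambda>x. f x y))"

text \<open>The underlying vector space is the whole type \<open>'v\<close>; the record carries the scalar
  multiplication and the bracket.\<close>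

record ('k, 'v) lie_alg =
  scal :: "'k \<Rightarrow> 'v \<Rightarrow> 'v"
  brk :: "'v \<Rightarrow> 'v \<Rightarrow> 'v"

definition lie_algebra :: "('k::field_char_0, 'v::ab_group_add, 'm) lie_alg_scheme \<Rightarrow> bool" where
  "lie_algebra L \<longleftrightarrow>
     vector_space (scal L) \<and>
     (\<exists>B. finite B \<and> module.span (scal L) B = UNIV) \<and>
     bilinear_map (scal L) (scal L) (scal L) (brk L) \<and>
     (\<forall>x. brk L x x = 0) \<and>
     (\<forall>x y z. brk L x (brk L y z) + brk L y (brk L z x) + brk L z (brk L x y) = 0)"

definition lie_hom ::
  "('k::field_char_0, 'v::ab_group_add, 'm) lie_alg_scheme \<Rightarrow>
   ('k, 'w::ab_group_add, 'n) lie_alg_scheme \<Rightarrow> ('v \<Rightarrow> 'w) \<Rightarrow> bool" where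
  "lie_hom L M f \<longleftrightarrow>
     Vector_Spaces.linear (scal L) (scal M) f \<and>
     (\<forall>x y. f (brk L x y) = brk M (f x) (f y))"

definition lie_ideal ::
  "('k::field_char_0, 'v::ab_group_add, 'm) lie_alg_scheme \<Rightarrow> 'v set \<Rightarrow> bool" where
  "lie_ideal L A \<longleftrightarrow>
     module.subspace (scal L) A \<and> (\<forall>x. \<forall>a\<in>A. brk L x a \<in> A)"

definition symplectic_lie_algebra ::
  "('k::field_char_0, 'v::ab_group_add, 'm) lie_alg_scheme \<Rightarrow> ('v \<Rightarrow> 'v \<Rightarrow> 'k) \<Rightarrow> bool" where
  "symplectic_lie_algebra L \<omega> \<longleftrightarrow>
     lie_algebra L \<and>
     bilinear_map (scal L) (scal L) (*) \<omega> \<and>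
     (\<forall>x. \<omega> x x = 0) \<and>
     (\<forall>x. (\<forall>y. \<omega> x y = 0) \<longrightarrow> x = 0) \<and>
     (\<forall>u v w. \<omega> (brk L u v) w + \<omega> (brk L w u) v + \<omega> (brk L v w) u = 0)"

definition orthogonal_space :: "('v \<Rightarrow> 'v \<Rightarrow> 'k::zero) \<Rightarrow> 'v set \<Rightarrow> 'v set" where
  "orthogonal_space \<omega> A = {x. \<forall>y\<in>A. \<omega> x y = 0}"

definition lagrangian_subspace ::
  "('k::field_char_0, 'v::ab_group_add, 'm) lie_alg_scheme \<Rightarrow> ('v \<Rightarrow> 'v \<Rightarrow> 'k) \<Rightarrow> 'v set \<Rightarrow> bool" where
  "lagrangian_subspace L \<omega> A \<longleftrightarrow>
     module.subspace (scal L) A \<and> A = orthogonal_space \<omega> A"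

definition flat_lie_algebra ::
  "('k::field_char_0, 'h::ab_group_add, 'm) lie_alg_scheme \<Rightarrow> ('h \<Rightarrow> 'h \<Rightarrow> 'h) \<Rightarrow> bool" where
  "flat_lie_algebra H nabla \<longleftrightarrow>
     lie_algebra H \<and>
     bilinear_map (scal H) (scal H) (scal H) nabla \<and>
     (\<forall>u v. nabla u v - nabla v u = brk H u v) \<and>
     (\<forall>u v w. nabla u (nabla v w) - nabla v (nabla u w) = nabla (brk H u v) w)"


section \<open>Lagrangian extension cohomology\<close>

definition dual_scal :: "'k::field \<Rightarrow> ('h \<Rightarrow> 'k) \<Rightarrow> ('h \<Rightarrow> 'k)" where
  "dual_scal c \<xi> = (\<lambda>v. c * \<xi> v)"

definition dual_space ::
  "('k::field_char_0, 'h::ab_group_add, 'm) lie_alg_scheme \<Rightarrow> ('h \<Rightarrow> 'k) set" where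
  "dual_space H = {\<xi>. Vector_Spaces.linear (scal H) (*) \<xi>}"

definition dual_rep :: "('h \<Rightarrow> 'h \<Rightarrow> 'h) \<Rightarrow> 'h \<Rightarrow> ('h \<Rightarrow> 'k::field) \<Rightarrow> ('h \<Rightarrow> 'k)" where
  "dual_rep nabla u \<xi> = - (\<xi> \<circ> nabla u)"

definition C1_L ::
  "('k::field_char_0, 'h::ab_group_add, 'm) lie_alg_scheme \<Rightarrow> ('h \<Rightarrow> 'h \<Rightarrow> 'k) set" where
  "C1_L H = {\<phi>. Vector_Spaces.linear (scal H) dual_scal \<phi> \<and> (\<forall>u. \<phi> u \<in> dual_space H) \<and>
                (\<forall>u v. \<phi> u v = \<phi> v u)}"

definition coboundary ::
  "('k::field_char_0, 'h::ab_group_add, 'm) lie_alg_scheme \<Rightarrow> ('h \<Rightarrow> 'h \<Rightarrow> 'h) \<Rightarrow>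
   ('h \<Rightarrow> 'h \<Rightarrow> 'k) \<Rightarrow> ('h \<Rightarrow> 'h \<Rightarrow> 'h \<Rightarrow> 'k)" where
  "coboundary H nabla \<phi> =
     (\<lambda>u v. dual_rep nabla u (\<phi> v) - dual_rep nabla v (\<phi> u) - \<phi> (brk H u v))"

definition CE_cocycles2 ::
  "('k::field_char_0, 'h::ab_group_add, 'm) lie_alg_scheme \<Rightarrow> ('h \<Rightarrow> 'h \<Rightarrow> 'h) \<Rightarrow>
   ('h \<Rightarrow> 'h \<Rightarrow> 'h \<Rightarrow> 'k) set" where
  "CE_cocycles2 H nabla =
     {\<alpha>. bilinear_map (scal H) (scal H) dual_scal \<alpha> \<and>
          (\<forall>u v. \<alpha> u v \<in> dual_space H) \<and>
          (\<forall>u. \<alpha> u u = 0) \<and>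
          (\<forall>u v w. dual_rep nabla u (\<alpha> v w) + dual_rep nabla v (\<alpha> w u) + dual_rep nabla w (\<alpha> u v)
                   - \<alpha> (brk H u v) w - \<alpha> (brk H v w) u - \<alpha> (brk H w u) v = 0)}"

definition Z2_L ::
  "('k::field_char_0, 'h::ab_group_add, 'm) lie_alg_scheme \<Rightarrow> ('h \<Rightarrow> 'h \<Rightarrow> 'h) \<Rightarrow>
   ('h \<Rightarrow> 'h \<Rightarrow> 'h \<Rightarrow> 'k) set" where
  "Z2_L H nabla =
     {\<alpha> \<in> CE_cocycles2 H nabla. \<forall>u v w. \<alpha> u v w + \<alpha> w u v + \<alpha> v w u = 0}"

definition cohomologous_L ::
  "('k::field_char_0, 'h::ab_group_add, 'm) lie_alg_scheme \<Rightarrow> ('h \<Rightarrow> 'h \<Rightarrow> 'h) \<Rightarrow>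
   (('h \<Rightarrow> 'h \<Rightarrow> 'h \<Rightarrow> 'k) \<times> ('h \<Rightarrow> 'h \<Rightarrow> 'h \<Rightarrow> 'k)) set" where
  "cohomologous_L H nabla =
     {(\<alpha>, \<beta>). \<alpha> \<in> Z2_L H nabla \<and> \<beta> \<in> Z2_L H nabla \<and> \<alpha> - \<beta> \<in> coboundary H nabla ` C1_L H}"

definition H2_L ::
  "('k::field_char_0, 'h::ab_group_add, 'm) lie_alg_scheme \<Rightarrow> ('h \<Rightarrow> 'h \<Rightarrow> 'h) \<Rightarrow>
   ('h \<Rightarrow> 'h \<Rightarrow> 'h \<Rightarrow> 'k) set set" where
  "H2_L H nabla = Z2_L H nabla // cohomologous_L H nabla"

definition cohomology_class_L ::
  "('k::field_char_0, 'h::ab_group_add, 'm) lie_alg_scheme \<Rightarrow> ('h \<Rightarrow> 'h \<Rightarrow> 'h) \<Rightarrow>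
   ('h \<Rightarrow> 'h \<Rightarrow> 'h \<Rightarrow> 'k) \<Rightarrow> ('h \<Rightarrow> 'h \<Rightarrow> 'h \<Rightarrow> 'k) set" where
  "cohomology_class_L H nabla \<alpha> = cohomologous_L H nabla `` {\<alpha>}"

lemma linear_dual_iff:
  fixes H :: "('k::field_char_0, 'h::ab_group_add, 'm) lie_alg_scheme"
  assumes "vector_space (scal H)"
  shows "\<xi> \<in> dual_space H \<longleftrightarrow>
      (\<forall>x y. \<xi> (x + y) = \<xi> x + \<xi> y) \<and> (\<forall>c x. \<xi> (scal H c x) = c * \<xi> x)"
proof -
  have "vector_space ((*) :: 'k \<Rightarrow> 'k \<Rightarrow> 'k)"
    by unfold_locales (auto simp: algebra_simps)
  then show ?thesis
    using assms by (auto simp: dual_space_def Vector_Spaces.linear_def module_hom_def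
      module_hom_axioms_def vector_space_def module_def)
qed

lemma linear_to_dual_iff:
  fixes H :: "('k::field_char_0, 'h::ab_group_add, 'm) lie_alg_scheme"
    and \<phi> :: "'h \<Rightarrow> 'h \<Rightarrow> 'k"
  assumes "vector_space (scal H)"
  shows "Vector_Spaces.linear (scal H) dual_scal \<phi> \<longleftrightarrow>
      (\<forall>x y v. \<phi> (x + y) v = \<phi> x v + \<phi> y v) \<and> (\<forall>c x v. \<phi> (scal H c x) v = c * \<phi> x v)"
proof -
  have "vector_space (dual_scal :: 'k \<Rightarrow> ('h \<Rightarrow> 'k) \<Rightarrow> _)"
    by unfold_locales (auto simp: algebra_simps dual_scal_def fun_eq_iff)
  then show ?thesis
    using assms by (auto simp: Vector_Spaces.linear_def module_hom_def
      module_hom_axioms_def vector_space_def module_def fun_eq_iff dual_scal_def)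
qed

lemma coboundary_in_Z2_L:
  fixes H :: "('k::field_char_0, 'h::ab_group_add, 'm) lie_alg_scheme"
  assumes flat: "flat_lie_algebra H nabla"
  shows "coboundary H nabla ` C1_L H \<subseteq> Z2_L H nabla"
proof
  fix \<alpha> assume "\<alpha> \<in> coboundary H nabla ` C1_L H"
  then obtain \<phi> where phi: "\<phi> \<in> C1_L H" and al: "\<alpha> = coboundary H nabla \<phi>" by blast
  have vs: "vector_space (scal H)" using flat by (simp add: flat_lie_algebra_def lie_algebra_def)
  note iffs = linear_dual_iff[OF vs] linear_to_dual_iff[OF vs]
  have p1: "\<phi> (x + y) v = \<phi> x v + \<phi> y v" "\<phi> (scal H c x) v = c * \<phi> x v"
    and p2: "\<phi> v (x + y) = \<phi> v x + \<phi> v y" "\<phi> v (scal H c x) = c * \<phi> v x"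
    and sym: "\<phi> x y = \<phi> y x" for x y v c
    using phi unfolding C1_L_def by (auto simp: iffs)
  have p3: "\<phi> v (x - y) = \<phi> v x - \<phi> v y" "\<phi> v (- y) = - \<phi> v y" "\<phi> v 0 = 0" for x y v
  proof -
    have d: "\<phi> v (x - y) = \<phi> v x - \<phi> v y" for x y using p2(1)[of v "x - y" y] by simp
    show "\<phi> v (x - y) = \<phi> v x - \<phi> v y" "\<phi> v (- y) = - \<phi> v y" "\<phi> v 0 = 0"
      using d[of x y] d[of 0 y] d[of 0 0] by auto
  qed
  have n1: "nabla u (x + y) = nabla u x + nabla u y" "nabla u (scal H c x) = scal H c (nabla u x)"
    and n2: "nabla (x + y) u = nabla x u + nabla y u" "nabla (scal H c x) u = scal H c (nabla x u)"
    and b1: "brk H u (x + y) = brk H u x + brk H u y" "brk H u (scal H c x) = scal H c (brk H u x)"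
    and b2: "brk H (x + y) u = brk H x u + brk H y u" "brk H (scal H c x) u = scal H c (brk H x u)"
    for u x y c
    using flat unfolding flat_lie_algebra_def lie_algebra_def bilinear_map_def
    by (auto simp: Vector_Spaces.linear_def module_hom_def module_hom_axioms_def)
  have br: "brk H u v = nabla u v - nabla v u" for u v
    using flat by (simp add: flat_lie_algebra_def)
  have curv: "nabla (brk H u v) w = nabla u (nabla v w) - nabla v (nabla u w)" for u v w
    using flat by (simp add: flat_lie_algebra_def)
  have jac: "\<phi> (brk H u (brk H v w)) x + \<phi> (brk H v (brk H w u)) x + \<phi> (brk H w (brk H u v)) x = 0"
    for u v w x
  proof -
    have "brk H u (brk H v w) + brk H v (brk H w u) + brk H w (brk H u v) = 0"
      using flat by (simp add: flat_lie_algebra_def lie_algebra_def)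
    then show ?thesis by (metis p1(1) p3(3) sym)
  qed
  have anti: "brk H u v = - brk H v u" for u v by (simp add: br)
  have ex: "\<alpha> u v w = - \<phi> v (nabla u w) + \<phi> u (nabla v w) - \<phi> (brk H u v) w" for u v w
    by (simp add: al coboundary_def dual_rep_def)
  have "\<alpha> u v \<in> dual_space H" for u v
    by (simp add: iffs ex p2 n1 algebra_simps)
  moreover have "bilinear_map (scal H) (scal H) dual_scal \<alpha>"
    unfolding bilinear_map_def by (simp add: iffs ex p1 p2 n1 n2 b1 b2 algebra_simps)
  moreover have "\<alpha> u u = 0" for u
    by (simp add: fun_eq_iff ex br p3 sym[of 0])
  moreover have "dual_rep nabla u (\<alpha> v w) + dual_rep nabla v (\<alpha> w u) + dual_rep nabla w (\<alpha> u v)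
                   - \<alpha> (brk H u v) w - \<alpha> (brk H v w) u - \<alpha> (brk H w u) v = 0" for u v w
  proof
    fix x
    have ne: "\<phi> (brk H (brk H a b) c) x = - \<phi> (brk H c (brk H a b)) x" for a b c
      by (metis anti p3(2) sym)
    show "(dual_rep nabla u (\<alpha> v w) + dual_rep nabla v (\<alpha> w u) + dual_rep nabla w (\<alpha> u v)
                   - \<alpha> (brk H u v) w - \<alpha> (brk H v w) u - \<alpha> (brk H w u) v) x = 0 x"
      using jac[of u v w x]
      by (simp add: dual_rep_def ex ne curv p3 algebra_simps)
  qed
  moreover have "\<alpha> u v w + \<alpha> w u v + \<alpha> v w u = 0" for u v w
  proof -
    have "\<phi> (brk H a b) c = \<phi> c (nabla a b) - \<phi> c (nabla b a)" for a b c
      by (metis br p3(1) sym)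
    then show ?thesis by (simp add: ex)
  qed
  ultimately show "\<alpha> \<in> Z2_L H nabla"
    by (simp add: Z2_L_def CE_cocycles2_def)
qed

lemma equiv_cohomologous_L:
  fixes H :: "('k::field_char_0, 'h::ab_group_add, 'm) lie_alg_scheme"
  assumes flat: "flat_lie_algebra H nabla"
  shows "equiv (Z2_L H nabla) (cohomologous_L H nabla)"
proof -
  have vs: "vector_space (scal H)" using flat by (simp add: flat_lie_algebra_def lie_algebra_def)
  note iffs = linear_dual_iff[OF vs] linear_to_dual_iff[OF vs]
  have z: "0 \<in> C1_L H" by (simp add: C1_L_def iffs)
  have m: "- \<phi> \<in> C1_L H" if "\<phi> \<in> C1_L H" for \<phi>
    using that by (simp add: C1_L_def iffs)
  have p: "\<phi> + \<psi> \<in> C1_L H" if "\<phi> \<in> C1_L H" "\<psi> \<in> C1_L H" for \<phi> \<psi>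
    using that by (simp add: C1_L_def iffs algebra_simps)
  have cz: "coboundary H nabla 0 = 0"
    by (simp add: coboundary_def dual_rep_def fun_eq_iff)
  have cm: "coboundary H nabla (- \<phi>) = - coboundary H nabla \<phi>" for \<phi>
    by (simp add: coboundary_def dual_rep_def fun_eq_iff)
  have cp: "coboundary H nabla (\<phi> + \<psi>) = coboundary H nabla \<phi> + coboundary H nabla \<psi>" for \<phi> \<psi>
    by (simp add: coboundary_def dual_rep_def fun_eq_iff)
  show ?thesis
  proof (rule equivI)
    show "cohomologous_L H nabla \<subseteq> Z2_L H nabla \<times> Z2_L H nabla"
      by (auto simp: cohomologous_L_def)
    show "refl_on (Z2_L H nabla) (cohomologous_L H nabla)"
      using z cz by (force simp: refl_on_def cohomologous_L_def)
    show "sym (cohomologous_L H nabla)"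
    proof (rule symI)
      fix \<alpha> \<beta> assume "(\<alpha>, \<beta>) \<in> cohomologous_L H nabla"
      then obtain \<phi> where "\<alpha> \<in> Z2_L H nabla" "\<beta> \<in> Z2_L H nabla" "\<phi> \<in> C1_L H"
        "\<alpha> - \<beta> = coboundary H nabla \<phi>" by (auto simp: cohomologous_L_def)
      moreover from this have "\<beta> - \<alpha> = coboundary H nabla (- \<phi>)"
        by (metis cm minus_diff_eq)
      ultimately show "(\<beta>, \<alpha>) \<in> cohomologous_L H nabla"
        using m by (simp add: cohomologous_L_def)
    qed
    show "trans (cohomologous_L H nabla)"
    proof (rule transI)
      fix \<alpha> \<beta> \<gamma> assume "(\<alpha>, \<beta>) \<in> cohomologous_L H nabla" "(\<beta>, \<gamma>) \<in> cohomologous_L H nabla"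
      then obtain \<phi> \<psi> where a: "\<alpha> \<in> Z2_L H nabla" "\<gamma> \<in> Z2_L H nabla" "\<phi> \<in> C1_L H" "\<psi> \<in> C1_L H"
        "\<alpha> - \<beta> = coboundary H nabla \<phi>" "\<beta> - \<gamma> = coboundary H nabla \<psi>"
        by (auto simp: cohomologous_L_def)
      have "\<alpha> - \<gamma> = (\<alpha> - \<beta>) + (\<beta> - \<gamma>)" by simp
      then have "\<alpha> - \<gamma> = coboundary H nabla (\<phi> + \<psi>)"
        unfolding a cp .
      then show "(\<alpha>, \<gamma>) \<in> cohomologous_L H nabla"
        using a p by (simp add: cohomologous_L_def)
    qed
  qed
qed


section \<open>Lagrangian symplectic extensions\<close>

text \<open>The kernel of the extension is given as a subset \<open>ideal E\<close> of the total space, i.e. it is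
  identified with its image under the injection of the exact sequence.\<close>

record ('k, 'g, 'h) lagr_ext = "('k, 'g) lie_alg" +
  form :: "'g \<Rightarrow> 'g \<Rightarrow> 'k"
  ideal :: "'g set"
  proj :: "'g \<Rightarrow> 'h"

definition lagrangian_extension ::
  "('k::field_char_0, 'h::ab_group_add, 'm) lie_alg_scheme \<Rightarrow>
   ('k, 'g::ab_group_add, 'h, 'n) lagr_ext_scheme \<Rightarrow> bool" where
  "lagrangian_extension H E \<longleftrightarrow>
     lie_algebra H \<and>
     symplectic_lie_algebra E (form E) \<and>
     lie_hom E H (proj E) \<and>
     surj (proj E) \<and>
     {x. proj E x = 0} = ideal E \<and>
     lie_ideal E (ideal E) \<and>
     lagrangian_subspace E (form E) (ideal E)"

text \<open>In the next definition \<open>x\<close>, \<open>y\<close> and \<open>z\<close> range over all lifts of \<open>u\<close>, \<open>v\<close> and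
  \<open>nabla u v\<close>. By non-degeneracy and the Lagrangian condition at most one \<open>nabla\<close> satisfies it.\<close>

definition induces_connection ::
  "('k::field_char_0, 'g::ab_group_add, 'h, 'n) lagr_ext_scheme \<Rightarrow> ('h \<Rightarrow> 'h \<Rightarrow> 'h) \<Rightarrow> bool" where
  "induces_connection E nabla \<longleftrightarrow>
     (\<forall>u v. \<forall>x y z. \<forall>a\<in>ideal E.
        proj E x = u \<longrightarrow> proj E y = v \<longrightarrow> proj E z = nabla u v \<longrightarrow>
        form E z a = - form E y (brk E x a))"

definition lagrangian_extension_over ::
  "('k::field_char_0, 'h::ab_group_add, 'm) lie_alg_scheme \<Rightarrow> ('h \<Rightarrow> 'h \<Rightarrow> 'h) \<Rightarrow>
   ('k, 'g::ab_group_add, 'h, 'n) lagr_ext_scheme \<Rightarrow> bool" where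
  "lagrangian_extension_over H nabla E \<longleftrightarrow>
     flat_lie_algebra H nabla \<and> lagrangian_extension H E \<and> induces_connection E nabla"

definition lagrangian_extension_iso ::
  "('k::field_char_0, 'g::ab_group_add, 'h, 'm) lagr_ext_scheme \<Rightarrow>
   ('k, 'g2::ab_group_add, 'h, 'n) lagr_ext_scheme \<Rightarrow> ('g \<Rightarrow> 'g2) \<Rightarrow> bool" where
  "lagrangian_extension_iso E E' \<Phi> \<longleftrightarrow>
     lie_hom E E' \<Phi> \<and> bij \<Phi> \<and>
     (\<forall>x y. form E' (\<Phi> x) (\<Phi> y) = form E x y) \<and>
     \<Phi> ` ideal E = ideal E' \<and>
     (\<forall>x. proj E' (\<Phi> x) = proj E x)"

definition isomorphic_extensions ::
  "('k::field_char_0, 'g::ab_group_add, 'h, 'm) lagr_ext_scheme \<Rightarrow>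
   ('k, 'g2::ab_group_add, 'h, 'n) lagr_ext_scheme \<Rightarrow> bool" where
  "isomorphic_extensions E E' \<longleftrightarrow> (\<exists>\<Phi>. lagrangian_extension_iso E E' \<Phi>)"


section \<open>The extension class\<close>

definition lagrangian_complement ::
  "('k::field_char_0, 'g::ab_group_add, 'h, 'n) lagr_ext_scheme \<Rightarrow> 'g set \<Rightarrow> bool" where
  "lagrangian_complement E N \<longleftrightarrow>
     lagrangian_subspace E (form E) N \<and>
     ideal E \<inter> N = {0} \<and>
     (\<forall>x. \<exists>a\<in>ideal E. \<exists>n\<in>N. x = a + n)"

definition ideal_proj ::
  "('k, 'g::ab_group_add, 'h, 'n) lagr_ext_scheme \<Rightarrow> 'g set \<Rightarrow> 'g \<Rightarrow> 'g" where
  "ideal_proj E N x = (THE a. a \<in> ideal E \<and> x - a \<in> N)"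

definition lift ::
  "('k, 'g, 'h, 'n) lagr_ext_scheme \<Rightarrow> 'g set \<Rightarrow> 'h \<Rightarrow> 'g" where
  "lift E N u = (THE x. x \<in> N \<and> proj E x = u)"

definition extension_cocycle ::
  "('k, 'g::ab_group_add, 'h, 'n) lagr_ext_scheme \<Rightarrow> 'g set \<Rightarrow> 'h \<Rightarrow> 'h \<Rightarrow> 'h \<Rightarrow> 'k" where
  "extension_cocycle E N =
     (\<lambda>u v w. form E (ideal_proj E N (brk E (lift E N u) (lift E N v))) (lift E N w))"

definition extension_class ::
  "('k::field_char_0, 'h::ab_group_add, 'm) lie_alg_scheme \<Rightarrow> ('h \<Rightarrow> 'h \<Rightarrow> 'h) \<Rightarrow>
   ('k, 'g::ab_group_add, 'h, 'n) lagr_ext_scheme \<Rightarrow> ('h \<Rightarrow> 'h \<Rightarrow> 'h \<Rightarrow> 'k) set" where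
  "extension_class H nabla E =
     (THE c. \<exists>N. lagrangian_complement E N \<and>
                 c = cohomology_class_L H nabla (extension_cocycle E N))"

end

(*
  A Lagrangian complement N is the same as an isotropic linear section s of the projection p, and
  its cocycle is w([s u, s v], s w). Non-degeneracy and finite dimension identify the ideal with
  the dual of h via a |-> w(a, s _); hence any linear section can be made isotropic by adding an
  ideal-valued correction (half of the defect w(s u, s v)), and the isotropic sections are exactly
  s + t with phi(u)(v) = w(t u, s v) symmetric. Such a change of section changes the cocycle by the
  coboundary of phi, and every phi in C1_L occurs.
  An element x is determined by its coordinates p x and w(x, s _), and the form and the bracket are
  expressed in these coordinates through nabla and the cocycle alone. So when two extensions have
  sections with the same cocycle, matching coordinates is an isomorphism.
*)
theory Submission
  imports Defs
begin

section \<open>Linear functionals and non-degenerate forms\<close>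

text \<open>Send \<open>x\<close> to the tuple of values of \<open>\<omega> x\<close> on a basis.
  Non-degeneracy makes this map injective, and finite dimension then makes it surjective.\<close>

lemma functional_represented:
  fixes s :: "'k::field \<Rightarrow> 'v::ab_group_add \<Rightarrow> 'v" and \<omega> :: "'v \<Rightarrow> 'v \<Rightarrow> 'k"
  assumes vs: "vector_space s"
    and fin: "finite C" "module.span s C = UNIV"
    and bil: "bilinear_map s s (*) \<omega>"
    and nondeg: "\<And>x. (\<And>y. \<omega> x y = 0) \<Longrightarrow> x = 0"
    and f: "Vector_Spaces.linear s (*) f"
  obtains x where "\<And>y. \<omega> x y = f y"
proof -
  interpret vector_space s by (rule vs)
  obtain B where B: "B \<subseteq> C" "independent B" "C \<subseteq> span B"
    using maximal_independent_subset by blast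
  have finB: "finite B" using B(1) fin(1) by (rule finite_subset)
  have spB: "span B = UNIV" using fin(2) span_minimal[OF B(3) subspace_span] by auto
  interpret finite_dimensional_vector_space s B
    by unfold_locales (auto simp: finB B spB)
  have coord: "c b = d b" if "(\<Sum>b\<in>B. s (c b) b) = (\<Sum>b\<in>B. s (d b) b)" "b \<in> B" for c d b
  proof -
    have "(\<Sum>b\<in>B. s (c b - d b) b) = 0"
      using that(1) by (simp add: scale_left_diff_distrib sum_subtractf)
    then have "c b - d b = 0"
      using independentD[OF B(2) finB order_refl, of "\<lambda>b. c b - d b"] that(2) by blast
    then show ?thesis by simp
  qed
  have wl: "\<omega> (x + y) z = \<omega> x z + \<omega> y z" "\<omega> (s c x) z = c * \<omega> x z"
    and wr: "Vector_Spaces.linear s (*) (\<omega> x)" for x y z c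
    using bil by (auto simp: bilinear_map_def Vector_Spaces.linear_iff)
  have vk: "vector_space ((*) :: 'k \<Rightarrow> 'k \<Rightarrow> 'k)" by unfold_locales (auto simp: algebra_simps)
  interpret vector_space_pair s "(*) :: 'k \<Rightarrow> 'k \<Rightarrow> 'k"
    using vs vk by (simp add: vector_space_pair_def)
  have eqB: "g = h" if "Vector_Spaces.linear s (*) g" "Vector_Spaces.linear s (*) h"
    "\<And>b. b \<in> B \<Longrightarrow> g b = h b" for g h
  proof
    fix x
    have "x \<in> span B" using spB by simp
    then show "g x = h x" using linear_eq_on_span[OF that(1,2)] that(3) by blast
  qed
  \<comment> \<open>Storing the values of \<open>\<omega> x\<close> on \<open>B\<close> as the
    coordinates of a vector makes \<open>T\<close> an endomorphism of the space itself, so no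
    dimension count for the dual is required.\<close>
  define T where "T x = (\<Sum>b\<in>B. s (\<omega> x b) b)" for x
  have linT: "Vector_Spaces.linear s s T"
    by (simp add: T_def Vector_Spaces.linear_iff vs wl scale_left_distrib sum.distrib scale_sum_right)
  interpret T: Vector_Spaces.linear s s T by (rule linT)
  have "x = 0" if "T x = 0" for x
  proof (rule nondeg)
    have "\<omega> x b = 0" if "b \<in> B" for b
      using coord[of "\<omega> x" "\<lambda>_. 0"] \<open>T x = 0\<close> that by (simp add: T_def)
    then have "\<omega> x = (\<lambda>_. 0)"
      by (intro eqB wr) (auto simp: Vector_Spaces.linear_iff vs vk)
    then show "\<omega> x y = 0" for y by simp
  qed
  then have "inj T" by (auto simp: T.inj_iff_eq_0)
  then have "surj T" by (rule linear_inj_imp_surj[OF linT])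
  then obtain x where x: "T x = (\<Sum>b\<in>B. s (f b) b)" by (metis surjD)
  have "\<omega> x = f"
    using coord[of "\<omega> x" f] x by (intro eqB wr f) (simp add: T_def)
  then show thesis using that[of x] by simp
qed

section \<open>Lagrangian sections and basic identities in an extension\<close>

text \<open>Isotropy of the image already forces the image to be its own orthogonal, as
  \<open>lagrangian_complement_range\<close> shows.\<close>

definition lagrangian_section ::
  "('k::field_char_0, 'h::ab_group_add, 'm) lie_alg_scheme \<Rightarrow>
   ('k, 'g::ab_group_add, 'h, 'n) lagr_ext_scheme \<Rightarrow> ('h \<Rightarrow> 'g) \<Rightarrow> bool" where
  "lagrangian_section H E \<sigma> \<longleftrightarrow>
     Vector_Spaces.linear (scal H) (scal E) \<sigma> \<and>
     (\<forall>u. proj E (\<sigma> u) = u) \<and>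
     (\<forall>u v. form E (\<sigma> u) (\<sigma> v) = 0)"

text \<open>In contrast to \<open>extension_cocycle\<close>, the whole bracket is paired and not
  only its ideal component. For a Lagrangian section the rest lies in the isotropic image of
  \<open>\<sigma>\<close> and contributes nothing.\<close>

definition section_cocycle ::
  "('k, 'g, 'h, 'n) lagr_ext_scheme \<Rightarrow> ('h \<Rightarrow> 'g) \<Rightarrow> 'h \<Rightarrow> 'h \<Rightarrow> 'h \<Rightarrow> 'k" where
  "section_cocycle E \<sigma> = (\<lambda>u v w. form E (brk E (\<sigma> u) (\<sigma> v)) (\<sigma> w))"

locale flat_lagrangian_extension =
  fixes H :: "('k::field_char_0, 'h::ab_group_add, 'm) lie_alg_scheme"
    and nabla :: "'h \<Rightarrow> 'h \<Rightarrow> 'h"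
    and E :: "('k, 'g::ab_group_add, 'h, 'n) lagr_ext_scheme"
  assumes extension: "lagrangian_extension_over H nabla E"
begin

abbreviation "sH \<equiv> scal H"
abbreviation "sE \<equiv> scal E"
abbreviation "bH \<equiv> brk H"
abbreviation "bE \<equiv> brk E"
abbreviation "\<omega> \<equiv> form E"
abbreviation "p \<equiv> proj E"
abbreviation "A \<equiv> ideal E"

lemma
  shows flat: "flat_lie_algebra H nabla"
    and induces: "induces_connection E nabla"
    and lagr: "lagrangian_extension H E"
  using extension by (auto simp: lagrangian_extension_over_def)

lemma lieE: "lie_algebra E" and lieH: "lie_algebra H"
  using lagr by (auto simp: lagrangian_extension_def symplectic_lie_algebra_def)

lemma vsE: "vector_space sE" and vsH: "vector_space sH"
  using lieE lieH by (auto simp: lie_algebra_def)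

sublocale H: vector_space sH by (rule vsH)
sublocale E: vector_space sE by (rule vsE)

lemma bilinear_form: "bilinear_map sE sE (*) \<omega>"
  using lagr by (auto simp: lagrangian_extension_def symplectic_lie_algebra_def)

lemma form_linear [simp]:
  "\<omega> (x + y) z = \<omega> x z + \<omega> y z" "\<omega> (sE c x) z = c * \<omega> x z"
  "\<omega> z (x + y) = \<omega> z x + \<omega> z y" "\<omega> z (sE c x) = c * \<omega> z x"
  using bilinear_form by (auto simp: bilinear_map_def Vector_Spaces.linear_iff)

lemma form_minus [simp]:
  "\<omega> 0 z = 0" "\<omega> z 0 = 0" "\<omega> (- x) z = - \<omega> x z" "\<omega> z (- x) = - \<omega> z x"
  "\<omega> (x - y) z = \<omega> x z - \<omega> y z" "\<omega> z (x - y) = \<omega> z x - \<omega> z y"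
proof -
  have "\<omega> (x - y) z = \<omega> x z - \<omega> y z" "\<omega> z (x - y) = \<omega> z x - \<omega> z y" for x y
    using form_linear(1)[of "x - y" y z] form_linear(3)[of z "x - y" y] by simp_all
  from this this[of 0 x] this[of 0 0] this[of x y]
  show "\<omega> 0 z = 0" "\<omega> z 0 = 0" "\<omega> (- x) z = - \<omega> x z" "\<omega> z (- x) = - \<omega> z x"
    "\<omega> (x - y) z = \<omega> x z - \<omega> y z" "\<omega> z (x - y) = \<omega> z x - \<omega> z y" by simp_all
qed

lemma form_self [simp]: "\<omega> x x = 0"
  using lagr by (auto simp: lagrangian_extension_def symplectic_lie_algebra_def)

lemma form_swap: "\<omega> x y = - \<omega> y x"
  using form_self[of "x + y"]
  by (simp del: form_self add: form_self[of x] form_self[of y] eq_neg_iff_add_eq_0 add.commute)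

lemma form_nondegenerate: "(\<And>y. \<omega> x y = 0) \<Longrightarrow> x = 0"
  using lagr by (auto simp: lagrangian_extension_def symplectic_lie_algebra_def)

lemma form_closed: "\<omega> (bE u v) w + \<omega> (bE w u) v + \<omega> (bE v w) u = 0"
  using lagr by (auto simp: lagrangian_extension_def symplectic_lie_algebra_def)

lemma brk_linear [simp]:
  "bE (x + y) z = bE x z + bE y z" "bE (sE c x) z = sE c (bE x z)"
  "bE z (x + y) = bE z x + bE z y" "bE z (sE c x) = sE c (bE z x)"
  using lieE by (auto simp: lie_algebra_def bilinear_map_def Vector_Spaces.linear_iff)

lemma brk_self [simp]: "bE x x = 0"
  using lieE by (auto simp: lie_algebra_def)

lemma brk_swap: "bE x y = - bE y x"
  using brk_self[of "x + y"]
  by (simp del: brk_self add: brk_self[of x] brk_self[of y] eq_neg_iff_add_eq_0 add.commute)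

lemma brk_jacobi: "bE x (bE y z) + bE y (bE z x) + bE z (bE x y) = 0"
  using lieE by (auto simp: lie_algebra_def)

lemma linear_proj: "Vector_Spaces.linear sE sH p"
  using lagr by (auto simp: lagrangian_extension_def lie_hom_def)

lemma proj_hom [simp]:
  "p (x + y) = p x + p y" "p (sE c x) = sH c (p x)" "p (bE x y) = bH (p x) (p y)"
  using lagr by (auto simp: lagrangian_extension_def lie_hom_def Vector_Spaces.linear_iff)

lemma proj_diff [simp]: "p (x - y) = p x - p y"
  using proj_hom(1)[of "x - y" y] by simp

lemma mem_ideal_iff: "x \<in> A \<longleftrightarrow> p x = 0"
  using lagr by (auto simp: lagrangian_extension_def)

lemma mem_ideal_iff_orthogonal: "x \<in> A \<longleftrightarrow> (\<forall>a\<in>A. \<omega> x a = 0)"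
  using lagr by (auto simp: lagrangian_extension_def lagrangian_subspace_def orthogonal_space_def)

lemma form_ideal: "a \<in> A \<Longrightarrow> b \<in> A \<Longrightarrow> \<omega> a b = 0"
  using mem_ideal_iff_orthogonal by blast

lemma brk_mem_ideal: "a \<in> A \<Longrightarrow> bE x a \<in> A"
  using lagr by (auto simp: lagrangian_extension_def lie_ideal_def)

text \<open>Closedness of the form rewrites \<open>\<omega> (bE a b) z\<close> through brackets of
  \<open>z\<close> with \<open>a\<close> and with \<open>b\<close>. These stay in the ideal, which
  is isotropic.\<close>

lemma ideal_abelian:
  assumes "a \<in> A" "b \<in> A"
  shows "bE a b = 0"
proof (rule form_nondegenerate)
  fix z
  have "\<omega> (bE z a) b = 0" "\<omega> (bE b z) a = 0"
    using brk_mem_ideal assms form_ideal brk_swap[of b z] by auto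
  then show "\<omega> (bE a b) z = 0" using form_closed[of a b z] by simp
qed

lemma connection: "p z = nabla (p x) (p y) \<Longrightarrow> a \<in> A \<Longrightarrow> \<omega> z a = - \<omega> y (bE x a)"
  using induces by (auto simp: induces_connection_def)

section \<open>The pairing of the ideal with the dual of \<open>H\<close>, and corrections of
  sections\<close>

lemma linear_section_ex: "\<exists>\<sigma>. Vector_Spaces.linear sH sE \<sigma> \<and> (\<forall>u. p (\<sigma> u) = u)"
proof -
  interpret vector_space_pair sE sH using vsE vsH by (simp add: vector_space_pair_def)
  have "surj p" using lagr by (simp add: lagrangian_extension_def)
  then show ?thesis
    using linear_surjective_right_inverse[OF linear_proj] by (auto simp: fun_eq_iff)
qed

lemma vs_field: "vector_space ((*) :: 'k \<Rightarrow> 'k \<Rightarrow> 'k)"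
  by unfold_locales (auto simp: algebra_simps)

text \<open>Injectivity of the pairing: every \<open>y\<close> differs from
  \<open>\<sigma> (p y)\<close> by an ideal element, and \<open>a\<close> is orthogonal to the
  ideal.\<close>

lemma eq_zero_if_pairing_zero:
  assumes "\<And>u. p (\<sigma> u) = u" "a \<in> A" "\<And>v. \<omega> a (\<sigma> v) = 0"
  shows "a = 0"
proof (rule form_nondegenerate)
  fix y
  have "y - \<sigma> (p y) \<in> A" using assms by (simp add: mem_ideal_iff)
  then have "\<omega> a (y - \<sigma> (p y)) = 0" using assms(2) form_ideal by blast
  then show "\<omega> a y = 0" using assms(3) by simp
qed

text \<open>The functional \<open>\<xi> \<circ> p\<close> is represented by some \<open>a\<close>.
  It vanishes on the ideal, so \<open>a\<close> lies in the orthogonal of the ideal, which is the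
  ideal itself.\<close>

lemma pairing_surjective:
  assumes \<sigma>: "\<And>u. p (\<sigma> u) = u" and \<xi>: "\<xi> \<in> dual_space H"
  obtains a where "a \<in> A" "\<And>v. \<omega> a (\<sigma> v) = \<xi> v"
proof -
  obtain C where C: "finite C" "module.span sE C = UNIV"
    using lieE by (auto simp: lie_algebra_def)
  have \<xi>': "\<xi> (x + y) = \<xi> x + \<xi> y" "\<xi> (sH c x) = c * \<xi> x" for x y c
    using \<xi> by (auto simp: linear_dual_iff[OF vsH])
  have "Vector_Spaces.linear sE (*) (\<lambda>x. \<xi> (p x))"
    by (simp add: Vector_Spaces.linear_iff vsE vs_field \<xi>')
  then obtain a where a: "\<And>y. \<omega> a y = \<xi> (p y)"
    using functional_represented[OF vsE C bilinear_form form_nondegenerate] by blast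
  have "\<xi> 0 = 0" using \<xi>'(1)[of 0 0] by simp
  then have "a \<in> A" by (subst mem_ideal_iff_orthogonal) (simp add: a mem_ideal_iff)
  then show thesis using that a \<sigma> by simp
qed

text \<open>Values of \<open>\<tau>\<close> are chosen pointwise. Linearity comes for free, since
  its defects lie in the ideal and pair to zero with \<open>\<sigma>\<close>.\<close>

lemma correction_ex:
  assumes \<sigma>: "\<And>u. p (\<sigma> u) = u" and lin\<sigma>: "Vector_Spaces.linear sH sE \<sigma>"
    and \<phi>: "Vector_Spaces.linear sH dual_scal \<phi>" "\<And>u. \<phi> u \<in> dual_space H"
  obtains \<tau> where "Vector_Spaces.linear sH sE \<tau>" "\<And>u. \<tau> u \<in> A" "\<And>u v. \<omega> (\<tau> u) (\<sigma> v) = \<phi> u v"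
proof -
  have "\<exists>a. a \<in> A \<and> (\<forall>v. \<omega> a (\<sigma> v) = \<phi> u v)" for u
    using pairing_surjective[OF \<sigma> \<phi>(2)] by metis
  then obtain \<tau> where \<tau>: "\<And>u. \<tau> u \<in> A" "\<And>u v. \<omega> (\<tau> u) (\<sigma> v) = \<phi> u v" by metis
  have "\<tau> (u + v) - (\<tau> u + \<tau> v) = 0" "\<tau> (sH c u) - sE c (\<tau> u) = 0" for u v c
    using \<phi>(1) \<tau> unfolding linear_to_dual_iff[OF vsH]
    by (auto intro!: eq_zero_if_pairing_zero[of \<sigma>] simp: \<sigma> mem_ideal_iff
        simp del: right_minus_eq)
  then have "Vector_Spaces.linear sH sE \<tau>" by (simp add: Vector_Spaces.linear_iff vsE vsH)
  with \<tau> show thesis using that by blast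
qed

text \<open>Assumption \<open>iso\<close> is
  \<open>\<omega> (\<sigma> u + \<tau> u) (\<sigma> v + \<tau> v) = 0\<close> after expansion; the
  term with two values of \<open>\<tau>\<close> vanishes on the ideal.\<close>

lemma lagrangian_section_add:
  assumes \<sigma>: "Vector_Spaces.linear sH sE \<sigma>" "\<And>u. p (\<sigma> u) = u"
    and \<tau>: "Vector_Spaces.linear sH sE \<tau>" "\<And>u. \<tau> u \<in> A"
    and iso: "\<And>u v. \<omega> (\<sigma> u) (\<sigma> v) + \<omega> (\<tau> u) (\<sigma> v) - \<omega> (\<tau> v) (\<sigma> u) = 0"
  shows "lagrangian_section H E (\<lambda>u. \<sigma> u + \<tau> u)"
proof -
  have "\<omega> (\<sigma> u) (\<tau> v) = - \<omega> (\<tau> v) (\<sigma> u)" for u v by (rule form_swap)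
  then show ?thesis
    using \<sigma> \<tau> iso form_ideal[OF \<tau>(2) \<tau>(2)]
    by (auto simp: lagrangian_section_def Vector_Spaces.linear_iff mem_ideal_iff algebra_simps)
qed

lemma lagrangian_section_ex: "\<exists>\<sigma>. lagrangian_section H E \<sigma>"
proof -
  obtain \<sigma> where \<sigma>: "Vector_Spaces.linear sH sE \<sigma>" "\<And>u. p (\<sigma> u) = u"
    using linear_section_ex by blast
  \<comment> \<open>The correction enters as \<open>\<phi> u v - \<phi> v u\<close>. As this
    \<open>\<phi>\<close> is alternating it counts twice, hence the factor one half.\<close>
  define \<phi> where "\<phi> u v = - \<omega> (\<sigma> u) (\<sigma> v) / 2" for u v
  have "Vector_Spaces.linear sH dual_scal \<phi>" "\<phi> u \<in> dual_space H" for u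
    using \<sigma>(1) unfolding linear_to_dual_iff[OF vsH] linear_dual_iff[OF vsH]
    by (auto simp: \<phi>_def Vector_Spaces.linear_iff field_simps)
  then obtain \<tau> where \<tau>: "Vector_Spaces.linear sH sE \<tau>" "\<And>u. \<tau> u \<in> A"
    "\<And>u v. \<omega> (\<tau> u) (\<sigma> v) = \<phi> u v"
    using correction_ex[OF \<sigma>(2,1)] by blast
  have "\<omega> (\<sigma> u) (\<sigma> v) + \<omega> (\<tau> u) (\<sigma> v) - \<omega> (\<tau> v) (\<sigma> u) = 0" for u v
    using form_swap[of "\<sigma> v" "\<sigma> u"] by (simp add: \<tau> \<phi>_def field_simps)
  then show ?thesis using lagrangian_section_add[OF \<sigma> \<tau>(1,2)] by blast
qed

section \<open>Coordinates with respect to a fixed Lagrangian section\<close>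

context
  fixes \<sigma>
  assumes sec: "lagrangian_section H E \<sigma>"
begin

lemma section_linear:
  "\<sigma> (u + v) = \<sigma> u + \<sigma> v" "\<sigma> (sH c u) = sE c (\<sigma> u)"
  using sec by (auto simp: lagrangian_section_def Vector_Spaces.linear_iff)

lemma section_proj: "p (\<sigma> u) = u" and section_isotropic: "\<omega> (\<sigma> u) (\<sigma> v) = 0"
  using sec by (auto simp: lagrangian_section_def)

lemma section_remainder: "x - \<sigma> (p x) \<in> A"
  by (simp add: mem_ideal_iff section_proj)

lemma form_remainder: "\<omega> (x - \<sigma> (p x)) (\<sigma> w) = \<omega> x (\<sigma> w)"
  by (simp add: section_isotropic)

text \<open>Under the pairing, the action of \<open>\<sigma> u\<close> on the ideal becomes
  \<open>dual_rep nabla u\<close>; this is the defining property of the induced connection.\<close>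

lemma form_brk_section: "a \<in> A \<Longrightarrow> \<omega> (bE (\<sigma> u) a) (\<sigma> w) = - \<omega> a (\<sigma> (nabla u w))"
  using connection[of "\<sigma> (nabla u w)" "\<sigma> u" "\<sigma> w" a]
    form_swap[of a "\<sigma> (nabla u w)"] form_swap[of "bE (\<sigma> u) a" "\<sigma> w"]
  by (simp add: section_proj)

text \<open>The remainders of \<open>x\<close> and \<open>y\<close> both lie in the isotropic ideal;
  expanding their vanishing pairing gives the form in coordinates.\<close>

lemma form_eq_section: "\<omega> x y = \<omega> x (\<sigma> (p y)) - \<omega> y (\<sigma> (p x))"
  using form_ideal[OF section_remainder[of x] section_remainder[of y]] form_swap[of "\<sigma> (p x)" y]
  by (simp add: section_isotropic algebra_simps)

lemma eq_if_section_coordinates_eq: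
  assumes "p x = p y" "\<And>v. \<omega> x (\<sigma> v) = \<omega> y (\<sigma> v)"
  shows "x = y"
  using eq_zero_if_pairing_zero[of \<sigma> "x - y"] assms by (simp add: section_proj mem_ideal_iff)

text \<open>Together with \<open>eq_if_section_coordinates_eq\<close> this identifies the total
  space with the sum of \<open>H\<close> and its dual. Isotropy of \<open>\<sigma>\<close> keeps
  \<open>\<sigma> u\<close> from disturbing the second coordinate.\<close>

lemma section_coordinates_ex:
  assumes "\<xi> \<in> dual_space H"
  shows "\<exists>x. p x = u \<and> (\<forall>v. \<omega> x (\<sigma> v) = \<xi> v)"
proof -
  obtain a where "a \<in> A" "\<And>v. \<omega> a (\<sigma> v) = \<xi> v"
    using pairing_surjective[OF section_proj assms] by blast
  then have "p (\<sigma> u + a) = u \<and> (\<forall>v. \<omega> (\<sigma> u + a) (\<sigma> v) = \<xi> v)"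
    by (simp add: mem_ideal_iff section_proj section_isotropic)
  then show ?thesis by blast
qed

lemma form_section_dual: "(\<lambda>v. \<omega> x (\<sigma> v)) \<in> dual_space H"
  by (simp add: linear_dual_iff[OF vsH] section_linear)

text \<open>Both arguments are split into section part and remainder. The bracket of the remainders
  vanishes, the mixed brackets are governed by the connection, and a remainder has the same pairing
  with \<open>\<sigma>\<close> as the full element.\<close>

lemma form_brk_eq_section:
  "\<omega> (bE x y) (\<sigma> w) = section_cocycle E \<sigma> (p x) (p y) w
     - \<omega> y (\<sigma> (nabla (p x) w)) + \<omega> x (\<sigma> (nabla (p y) w))"
proof -
  define a b where "a = x - \<sigma> (p x)" and "b = y - \<sigma> (p y)"
  have ab: "a \<in> A" "b \<in> A" by (simp_all add: a_def b_def section_remainder)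
  have "x = \<sigma> (p x) + a" "y = \<sigma> (p y) + b" by (simp_all add: a_def b_def)
  then have "bE x y = bE (\<sigma> (p x) + a) (\<sigma> (p y) + b)" by simp
  also have "\<dots> = bE (\<sigma> (p x)) (\<sigma> (p y)) + bE (\<sigma> (p x)) b - bE (\<sigma> (p y)) a"
    using ideal_abelian[OF ab] brk_swap[of a "\<sigma> (p y)"] by simp
  finally have "\<omega> (bE x y) (\<sigma> w) = section_cocycle E \<sigma> (p x) (p y) w
      - \<omega> b (\<sigma> (nabla (p x) w)) + \<omega> a (\<sigma> (nabla (p y) w))"
    by (simp add: form_brk_section ab section_cocycle_def)
  then show ?thesis by (simp add: a_def b_def form_remainder del: form_minus)
qed

section \<open>The cocycle of a section and its dependence on the section\<close>

text \<open>The Chevalley-Eilenberg identity is the Jacobi identity paired with the section; the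
  cyclic condition is closedness of the form.\<close>

lemma section_cocycle_in_Z2_L: "section_cocycle E \<sigma> \<in> Z2_L H nabla"
proof -
  let ?\<alpha> = "section_cocycle E \<sigma>"
  have "bilinear_map sH sH dual_scal ?\<alpha>"
    unfolding bilinear_map_def linear_to_dual_iff[OF vsH]
    by (simp add: section_cocycle_def section_linear)
  moreover have "?\<alpha> u v \<in> dual_space H" for u v
    using form_section_dual[of "bE (\<sigma> u) (\<sigma> v)"] by (simp add: section_cocycle_def)
  moreover have "?\<alpha> u u = 0" for u
    by (simp add: section_cocycle_def fun_eq_iff)
  moreover have "dual_rep nabla u (?\<alpha> v w) + dual_rep nabla v (?\<alpha> w u) + dual_rep nabla w (?\<alpha> u v)
                   - ?\<alpha> (bH u v) w - ?\<alpha> (bH v w) u - ?\<alpha> (bH w u) v = 0" for u v w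
  proof
    fix x
    \<comment> \<open>Each nested bracket yields one representation term and one bracket term, so
      the cyclic Jacobi sum is exactly the coboundary expression.\<close>
    have expand: "\<omega> (bE (\<sigma> a) (bE (\<sigma> b) (\<sigma> c))) (\<sigma> x)
        = dual_rep nabla a (?\<alpha> b c) x - ?\<alpha> (bH b c) a x" for a b c
    proof -
      have "?\<alpha> a (bH b c) x = - ?\<alpha> (bH b c) a x"
        using brk_swap[of "\<sigma> a" "\<sigma> (bH b c)"] by (simp add: section_cocycle_def)
      then show ?thesis
        by (simp add: form_brk_eq_section section_proj section_isotropic dual_rep_def)
    qed
    have "\<omega> (bE (\<sigma> u) (bE (\<sigma> v) (\<sigma> w)) + bE (\<sigma> v) (bE (\<sigma> w) (\<sigma> u))
        + bE (\<sigma> w) (bE (\<sigma> u) (\<sigma> v))) (\<sigma> x) = 0"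
      by (simp only: brk_jacobi form_minus)
    then show "(dual_rep nabla u (?\<alpha> v w) + dual_rep nabla v (?\<alpha> w u) + dual_rep nabla w (?\<alpha> u v)
                   - ?\<alpha> (bH u v) w - ?\<alpha> (bH v w) u - ?\<alpha> (bH w u) v) x = 0 x"
      by (simp add: expand algebra_simps)
  qed
  moreover have "?\<alpha> u v w + ?\<alpha> w u v + ?\<alpha> v w u = 0" for u v w
    using form_closed by (simp add: section_cocycle_def)
  ultimately show ?thesis by (simp add: Z2_L_def CE_cocycles2_def)
qed

text \<open>The element \<open>\<sigma> u + \<tau> u\<close> has coordinates \<open>u\<close> and
  \<open>\<omega> (\<tau> u) (\<sigma> _)\<close>, so the coordinate formulas for bracket and form
  can be applied directly.\<close>

lemma section_cocycle_add:
  assumes sec': "lagrangian_section H E (\<lambda>u. \<sigma> u + \<tau> u)" and \<tau>: "\<And>u. \<tau> u \<in> A"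
  shows "section_cocycle E (\<lambda>u. \<sigma> u + \<tau> u) - section_cocycle E \<sigma>
    = coboundary H nabla (\<lambda>u v. \<omega> (\<tau> u) (\<sigma> v))"
proof (intro ext)
  fix u v w
  have sym: "\<omega> (\<tau> u) (\<sigma> v) = \<omega> (\<tau> v) (\<sigma> u)" for u v
  proof -
    have "\<omega> (\<sigma> u + \<tau> u) (\<sigma> v + \<tau> v) = 0"
      using sec' by (simp add: lagrangian_section_def)
    then show ?thesis
      using form_ideal[OF \<tau> \<tau>] form_swap[of "\<sigma> u" "\<tau> v"] by (simp add: section_isotropic)
  qed
  have p\<tau>: "p (\<sigma> u + \<tau> u) = u" for u
    using \<tau>[of u] by (simp add: mem_ideal_iff section_proj)
  let ?b = "bE (\<sigma> u + \<tau> u) (\<sigma> v + \<tau> v)"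
  have pb: "p ?b = bH u v" by (simp only: proj_hom(3) p\<tau>)
  \<comment> \<open>As \<open>p (\<tau> w) = 0\<close>, only one term of
    \<open>form_eq_section\<close> survives; the instance of \<open>section_linear\<close> supplies
    \<open>\<sigma> 0 = 0\<close>.\<close>
  have "\<omega> ?b (\<tau> w) = - \<omega> (\<tau> w) (\<sigma> (bH u v))"
    using form_eq_section[of ?b "\<tau> w"] \<tau>[of w] section_linear(2)[of 0 0]
    by (simp only: pb) (simp add: mem_ideal_iff)
  moreover have "\<omega> ?b (\<sigma> w) = section_cocycle E \<sigma> u v w
      - \<omega> (\<tau> v) (\<sigma> (nabla u w)) + \<omega> (\<tau> u) (\<sigma> (nabla v w))"
    by (simp only: form_brk_eq_section p\<tau> form_linear section_isotropic add_0_left)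
  moreover have "section_cocycle E (\<lambda>u. \<sigma> u + \<tau> u) u v w = \<omega> ?b (\<sigma> w) + \<omega> ?b (\<tau> w)"
    by (simp only: section_cocycle_def form_linear)
  ultimately show "(section_cocycle E (\<lambda>u. \<sigma> u + \<tau> u) - section_cocycle E \<sigma>) u v w
      = coboundary H nabla (\<lambda>u v. \<omega> (\<tau> u) (\<sigma> v)) u v w"
    \<comment> \<open>Symmetry turns the pairing of \<open>\<tau> w\<close> with
      \<open>\<sigma> (bH u v)\<close> into the bracket term of the coboundary.\<close>
    using sym[of "bH u v" w] by (simp add: coboundary_def dual_rep_def)
qed

text \<open>The difference of two sections takes values in the ideal because both lift
  \<open>u\<close>, and its pairing is symmetric because both are isotropic.\<close>

lemma section_cocycle_cohomologous:
  assumes sec': "lagrangian_section H E \<sigma>'"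
  shows "(section_cocycle E \<sigma>', section_cocycle E \<sigma>) \<in> cohomologous_L H nabla"
proof -
  define \<tau> where "\<tau> u = \<sigma>' u - \<sigma> u" for u
  have eq: "\<sigma>' = (\<lambda>u. \<sigma> u + \<tau> u)" by (simp add: \<tau>_def)
  have s': "\<sigma>' (u + v) = \<sigma>' u + \<sigma>' v" "\<sigma>' (sH c u) = sE c (\<sigma>' u)" "p (\<sigma>' u) = u" "\<omega> (\<sigma>' u) (\<sigma>' v) = 0" for u v c
    using sec' by (auto simp: lagrangian_section_def Vector_Spaces.linear_iff)
  have \<tau>: "\<tau> u \<in> A" for u by (simp add: \<tau>_def mem_ideal_iff section_proj s')
  have sym: "\<omega> (\<tau> u) (\<sigma> v) = \<omega> (\<tau> v) (\<sigma> u)" for u v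
    using form_ideal[OF \<tau>[of u] \<tau>[of v]] form_swap[of "\<sigma> u" "\<sigma>' v"]
    by (simp add: \<tau>_def section_isotropic s')
  have "(\<lambda>u v. \<omega> (\<tau> u) (\<sigma> v)) \<in> C1_L H"
    unfolding C1_L_def linear_to_dual_iff[OF vsH] linear_dual_iff[OF vsH]
    using sym by (auto simp: section_linear \<tau>_def s' algebra_simps)
  then show ?thesis
    using section_cocycle_add[of \<tau>] \<tau> sec' section_cocycle_in_Z2_L
      flat_lagrangian_extension.section_cocycle_in_Z2_L[OF flat_lagrangian_extension_axioms sec']
    unfolding cohomologous_L_def eq by auto
qed

text \<open>Realizes every coboundary by a change of section: symmetry of \<open>\<phi>\<close> is
  what keeps the corrected section isotropic.\<close>

lemma section_cocycle_shift:
  assumes \<phi>: "\<phi> \<in> C1_L H"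
  obtains \<sigma>' where "lagrangian_section H E \<sigma>'"
    "section_cocycle E \<sigma>' - section_cocycle E \<sigma> = coboundary H nabla \<phi>"
proof -
  have lin: "Vector_Spaces.linear sH sE \<sigma>" using sec by (simp add: lagrangian_section_def)
  obtain \<tau> where \<tau>: "Vector_Spaces.linear sH sE \<tau>" "\<And>u. \<tau> u \<in> A"
    "\<And>u v. \<omega> (\<tau> u) (\<sigma> v) = \<phi> u v"
    using correction_ex[OF section_proj lin, of \<phi>] \<phi> by (auto simp: C1_L_def)
  have "lagrangian_section H E (\<lambda>u. \<sigma> u + \<tau> u)"
    using \<phi> by (intro lagrangian_section_add lin \<tau> section_proj)
      (auto simp: \<tau> section_isotropic C1_L_def)
  then show thesis using that section_cocycle_add[OF _ \<tau>(2)] \<tau>(3) by simp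
qed

section \<open>Lagrangian complements and Lagrangian sections\<close>

lemma lagrangian_complement_range: "lagrangian_complement E (range \<sigma>)"
proof -
  have zero: "\<sigma> 0 = 0" using section_linear(2)[of 0 0] by simp
  then have "E.subspace (range \<sigma>)"
    by (auto simp: E.subspace_def simp flip: section_linear intro: range_eqI[of _ _ 0])
  \<comment> \<open>Such an \<open>x\<close> has the same coordinates as
    \<open>\<sigma> (p x)\<close>.\<close>
  moreover have "x \<in> range \<sigma>" if "\<And>u. \<omega> x (\<sigma> u) = 0" for x
    using eq_if_section_coordinates_eq[of x "\<sigma> (p x)"] that
    by (simp add: section_proj section_isotropic)
  then have "range \<sigma> = orthogonal_space \<omega> (range \<sigma>)"
    by (auto simp: orthogonal_space_def section_isotropic)
  moreover have "A \<inter> range \<sigma> = {0}"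
    using zero section_proj[of 0] by (auto simp: mem_ideal_iff section_proj image_iff intro: exI[of _ 0])
  moreover have "\<exists>a\<in>A. \<exists>n\<in>range \<sigma>. x = a + n" for x
    using section_remainder[of x] by (metis diff_add_cancel rangeI)
  ultimately show ?thesis
    unfolding lagrangian_complement_def lagrangian_subspace_def by blast
qed

end

text \<open>Makes the definite description in \<open>lift\<close> meaningful: the decomposition
  gives existence, the trivial intersection uniqueness.\<close>

lemma complement_unique_lift:
  assumes "lagrangian_complement E N"
  shows "\<exists>!x. x \<in> N \<and> p x = u"
proof -
  have sub: "E.subspace N" and int: "A \<inter> N = {0}" and dec: "\<And>x. \<exists>a\<in>A. \<exists>n\<in>N. x = a + n"
    using assms by (auto simp: lagrangian_complement_def lagrangian_subspace_def)
  have "surj p" using lagr by (simp add: lagrangian_extension_def)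
  then obtain y where "p y = u" by (metis surjD)
  then obtain n where n: "n \<in> N" "p n = u"
    using dec[of y] by (auto simp: mem_ideal_iff)
  moreover have "x = n" if "x \<in> N" "p x = u" for x
  proof -
    have "x - n \<in> A \<inter> N" using that n E.subspace_diff[OF sub] by (simp add: mem_ideal_iff)
    then show ?thesis using int by simp
  qed
  ultimately show ?thesis by blast
qed

lemma lagrangian_section_lift:
  assumes N: "lagrangian_complement E N"
  shows "lagrangian_section H E (lift E N)" and "lift E N u \<in> N"
proof -
  have sub: "E.subspace N" and orth: "N = orthogonal_space \<omega> N"
    using N by (auto simp: lagrangian_complement_def lagrangian_subspace_def)
  have l: "lift E N u \<in> N" "p (lift E N u) = u" for u
    using theI'[OF complement_unique_lift[OF N, of u]] by (auto simp: lift_def)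
  have uniq: "x = lift E N u" if "x \<in> N" "p x = u" for x u
    using complement_unique_lift[OF N, of u] l that by blast
  \<comment> \<open>Sums and multiples of lifts stay in the subspace \<open>N\<close>, so uniqueness
    of lifts gives linearity.\<close>
  have "lift E N u + lift E N v = lift E N (u + v)" "sE c (lift E N u) = lift E N (sH c u)" for u v c
    using sub l by (auto intro!: uniq simp: E.subspace_def)
  moreover have "\<omega> (lift E N u) (lift E N v) = 0" for u v
    using l(1)[of u] l(1)[of v] orth by (auto simp: orthogonal_space_def)
  ultimately show "lagrangian_section H E (lift E N)"
    using l by (simp add: lagrangian_section_def Vector_Spaces.linear_iff vsE vsH)
  show "lift E N u \<in> N" by (rule l)
qed

text \<open>Projecting to the ideal along \<open>N\<close> subtracts the lift of the image in
  \<open>H\<close>, and that lift is orthogonal to all lifts.\<close>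

lemma extension_cocycle_eq:
  assumes N: "lagrangian_complement E N"
  shows "extension_cocycle E N = section_cocycle E (lift E N)"
proof (intro ext)
  fix u v w
  let ?\<sigma> = "lift E N" and ?x = "bE (lift E N u) (lift E N v)"
  note sec = lagrangian_section_lift[OF N]
  have sub: "E.subspace N" and int: "A \<inter> N = {0}"
    using N by (auto simp: lagrangian_complement_def lagrangian_subspace_def)
  have "ideal_proj E N ?x = ?x - ?\<sigma> (p ?x)"
    unfolding ideal_proj_def
  proof (rule the_equality)
    show "?x - ?\<sigma> (p ?x) \<in> A \<and> ?x - (?x - ?\<sigma> (p ?x)) \<in> N"
      using section_remainder[OF sec(1), of ?x] sec(2) by (simp del: proj_hom)
    fix a assume a: "a \<in> A \<and> ?x - a \<in> N"
    then have "?x - a = ?\<sigma> (p ?x)"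
      using complement_unique_lift[OF N, of "p ?x"] sec(2) section_proj[OF sec(1)]
      by (metis (no_types, lifting) diff_zero mem_ideal_iff proj_diff)
    then show "a = ?x - ?\<sigma> (p ?x)" by (metis add_diff_cancel_left' diff_add_cancel)
  qed
  then show "extension_cocycle E N u v w = section_cocycle E (lift E N) u v w"
    using form_remainder[OF sec(1)]
    by (simp add: extension_cocycle_def section_cocycle_def del: form_minus proj_hom)
qed

lemma lift_range:
  assumes sec: "lagrangian_section H E \<sigma>"
  shows "lift E (range \<sigma>) = \<sigma>"
proof
  show "lift E (range \<sigma>) u = \<sigma> u" for u
    unfolding lift_def using section_proj[OF sec] by (intro the_equality) auto
qed

section \<open>The extension class\<close>

lemma cohomology_class_eq_iff:
  assumes "\<alpha> \<in> Z2_L H nabla" "\<beta> \<in> Z2_L H nabla"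
  shows "cohomology_class_L H nabla \<alpha> = cohomology_class_L H nabla \<beta>
    \<longleftrightarrow> (\<alpha>, \<beta>) \<in> cohomologous_L H nabla"
  unfolding cohomology_class_L_def
  using eq_equiv_class_iff[OF equiv_cohomologous_L[OF flat] assms] .

text \<open>The image of \<open>\<sigma>\<close> is a complement giving this class, and any other
  complement gives a cohomologous cocycle through its lift.\<close>

lemma extension_class_eq:
  assumes sec: "lagrangian_section H E \<sigma>"
  shows "extension_class H nabla E = cohomology_class_L H nabla (section_cocycle E \<sigma>)"
  unfolding extension_class_def
proof (rule the_equality)
  show "\<exists>N. lagrangian_complement E N \<and>
      cohomology_class_L H nabla (section_cocycle E \<sigma>)
        = cohomology_class_L H nabla (extension_cocycle E N)"
    using lagrangian_complement_range[OF sec] extension_cocycle_eq[of "range \<sigma>"]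
    by (auto simp: lift_range[OF sec])
  fix c assume "\<exists>N. lagrangian_complement E N \<and>
      c = cohomology_class_L H nabla (extension_cocycle E N)"
  then obtain N where N: "lagrangian_complement E N"
    and c: "c = cohomology_class_L H nabla (section_cocycle E (lift E N))"
    using extension_cocycle_eq by auto
  note sec' = lagrangian_section_lift(1)[OF N]
  show "c = cohomology_class_L H nabla (section_cocycle E \<sigma>)"
    unfolding c using section_cocycle_cohomologous[OF sec sec']
    by (simp add: cohomology_class_eq_iff section_cocycle_in_Z2_L sec sec')
qed

end

section \<open>Isomorphisms of extensions\<close>

lemma section_coordinates_map:
  assumes E: "flat_lagrangian_extension H nabla E" and E': "flat_lagrangian_extension H nabla E'"
    and \<sigma>: "lagrangian_section H E \<sigma>" and \<sigma>': "lagrangian_section H E' \<sigma>'"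
  obtains \<Phi> where "\<And>x. proj E' (\<Phi> x) = proj E x" "\<And>x v. form E' (\<Phi> x) (\<sigma>' v) = form E x (\<sigma> v)"
proof -
  have "\<exists>y. proj E' y = proj E x \<and> (\<forall>v. form E' y (\<sigma>' v) = form E x (\<sigma> v))" for x
    using flat_lagrangian_extension.section_coordinates_ex[OF E' \<sigma>']
      flat_lagrangian_extension.form_section_dual[OF E \<sigma>] by blast
  then show thesis using that by metis
qed

text \<open>The map matching coordinates has the analogous map \<open>\<Psi>\<close> as inverse.
  Since coordinates determine an element, linearity and compatibility with the bracket are checked
  on them.\<close>

lemma isomorphic_if_section_cocycles_eq:
  assumes E: "flat_lagrangian_extension H nabla E" and E': "flat_lagrangian_extension H nabla E'"
    and \<sigma>: "lagrangian_section H E \<sigma>" and \<sigma>': "lagrangian_section H E' \<sigma>'"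
    and eq: "section_cocycle E \<sigma> = section_cocycle E' \<sigma>'"
  shows "isomorphic_extensions E E'"
proof -
  interpret E: flat_lagrangian_extension H nabla E by (rule E)
  interpret E': flat_lagrangian_extension H nabla E' by (rule E')
  obtain \<Phi> where \<Phi>: "\<And>x. proj E' (\<Phi> x) = proj E x" "\<And>x v. form E' (\<Phi> x) (\<sigma>' v) = form E x (\<sigma> v)"
    using section_coordinates_map[OF E E' \<sigma> \<sigma>'] by blast
  obtain \<Psi> where \<Psi>: "\<And>x. proj E (\<Psi> x) = proj E' x" "\<And>x v. form E (\<Psi> x) (\<sigma> v) = form E' x (\<sigma>' v)"
    using section_coordinates_map[OF E' E \<sigma>' \<sigma>] by blast
  note eqI = E.eq_if_section_coordinates_eq[OF \<sigma>] and eqI' = E'.eq_if_section_coordinates_eq[OF \<sigma>']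
  have inv: "\<Psi> (\<Phi> x) = x" "\<Phi> (\<Psi> y) = y" for x y
    by (auto intro!: eqI eqI' simp: \<Phi> \<Psi>)
  have "\<Phi> (x + y) = \<Phi> x + \<Phi> y" "\<Phi> (scal E c x) = scal E' c (\<Phi> x)" for x y c
    by (auto intro!: eqI' simp: \<Phi>)
  \<comment> \<open>In both extensions the coordinates of a bracket involve only
    \<open>nabla\<close>, the common cocycle and the coordinates of the arguments.\<close>
  moreover have "\<Phi> (brk E x y) = brk E' (\<Phi> x) (\<Phi> y)" for x y
    by (rule eqI')
      (simp_all add: \<Phi> eq E.form_brk_eq_section[OF \<sigma>] E'.form_brk_eq_section[OF \<sigma>'])
  ultimately have "lie_hom E E' \<Phi>"
    by (simp add: lie_hom_def Vector_Spaces.linear_iff E.vsE E'.vsE)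
  moreover have "bij \<Phi>" using inv by (rule o_bij[of \<Psi>, OF ext ext, unfolded o_def id_def])
  moreover have "form E' (\<Phi> x) (\<Phi> y) = form E x y" for x y
    using E.form_eq_section[OF \<sigma>, of x y] E'.form_eq_section[OF \<sigma>', of "\<Phi> x" "\<Phi> y"] by (simp add: \<Phi>)
  moreover have "\<Phi> ` ideal E = ideal E'"
  proof
    show "\<Phi> ` ideal E \<subseteq> ideal E'" by (auto simp: E.mem_ideal_iff E'.mem_ideal_iff \<Phi>)
    show "ideal E' \<subseteq> \<Phi> ` ideal E"
    proof
      fix y assume "y \<in> ideal E'"
      then have "\<Psi> y \<in> ideal E" by (simp add: E.mem_ideal_iff E'.mem_ideal_iff \<Psi>)
      then show "y \<in> \<Phi> ` ideal E" by (metis imageI inv(2))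
    qed
  qed
  ultimately show ?thesis
    using \<Phi>(1) unfolding isomorphic_extensions_def lagrangian_extension_iso_def by blast
qed

text \<open>An isomorphism preserves bracket, form and projection, hence carries a section to a
  section with the very same cocycle.\<close>

lemma lagrangian_section_comp_iso:
  assumes E: "flat_lagrangian_extension H nabla E"
    and \<sigma>: "lagrangian_section H E \<sigma>" and \<Phi>: "lagrangian_extension_iso E E' \<Phi>"
  shows "lagrangian_section H E' (\<Phi> \<circ> \<sigma>)"
    and "section_cocycle E' (\<Phi> \<circ> \<sigma>) = section_cocycle E \<sigma>"
proof -
  have lin: "Vector_Spaces.linear (scal E) (scal E') \<Phi>"
    and hom: "\<And>x y. \<Phi> (brk E x y) = brk E' (\<Phi> x) (\<Phi> y)"
    and form: "\<And>x y. form E' (\<Phi> x) (\<Phi> y) = form E x y"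
    and proj: "\<And>x. proj E' (\<Phi> x) = proj E x"
    using \<Phi> by (auto simp: lagrangian_extension_iso_def lie_hom_def)
  show "lagrangian_section H E' (\<Phi> \<circ> \<sigma>)"
    using \<sigma> lin form proj Vector_Spaces.linear_compose[of "scal H" "scal E" \<sigma> "scal E'" \<Phi>]
    by (simp add: lagrangian_section_def)
  show "section_cocycle E' (\<Phi> \<circ> \<sigma>) = section_cocycle E \<sigma>"
    by (simp add: section_cocycle_def form flip: hom)
qed

lemma isomorphic_iff_extension_class_eq:
  assumes E: "flat_lagrangian_extension H nabla E" and E': "flat_lagrangian_extension H nabla E'"
  shows "isomorphic_extensions E E' \<longleftrightarrow> extension_class H nabla E = extension_class H nabla E'"
proof -
  interpret E: flat_lagrangian_extension H nabla E by (rule E)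
  interpret E': flat_lagrangian_extension H nabla E' by (rule E')
  obtain \<sigma> where \<sigma>: "lagrangian_section H E \<sigma>" using E.lagrangian_section_ex by blast
  obtain \<sigma>' where \<sigma>': "lagrangian_section H E' \<sigma>'" using E'.lagrangian_section_ex by blast
  show ?thesis
  proof
    assume "isomorphic_extensions E E'"
    then obtain \<Phi> where "lagrangian_extension_iso E E' \<Phi>" by (auto simp: isomorphic_extensions_def)
    note \<Phi>\<sigma> = lagrangian_section_comp_iso[OF E \<sigma> this]
    show "extension_class H nabla E = extension_class H nabla E'"
      by (simp only: E.extension_class_eq[OF \<sigma>] E'.extension_class_eq[OF \<Phi>\<sigma>(1)] \<Phi>\<sigma>(2))
  next
    assume "extension_class H nabla E = extension_class H nabla E'"
    then have "(section_cocycle E \<sigma>, section_cocycle E' \<sigma>') \<in> cohomologous_L H nabla"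
      by (simp add: E.extension_class_eq[OF \<sigma>] E'.extension_class_eq[OF \<sigma>'] E.cohomology_class_eq_iff
        E.section_cocycle_in_Z2_L[OF \<sigma>] E'.section_cocycle_in_Z2_L[OF \<sigma>'])
    then obtain \<phi> where \<phi>: "\<phi> \<in> C1_L H"
      "section_cocycle E \<sigma> - section_cocycle E' \<sigma>' = coboundary H nabla \<phi>"
      by (auto simp: cohomologous_L_def)
    \<comment> \<open>Moving \<open>\<sigma>'\<close> by \<open>\<phi>\<close> absorbs the
      coboundary, so that the two cocycles become equal and not merely cohomologous.\<close>
    obtain \<sigma>'' where \<sigma>'': "lagrangian_section H E' \<sigma>''"
      "section_cocycle E' \<sigma>'' - section_cocycle E' \<sigma>' = coboundary H nabla \<phi>"
      using E'.section_cocycle_shift[OF \<sigma>' \<phi>(1)] by blast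
    have "section_cocycle E \<sigma> = section_cocycle E' \<sigma>''"
      using \<phi>(2) \<sigma>''(2) by (metis diff_add_cancel)
    then show "isomorphic_extensions E E'"
      by (rule isomorphic_if_section_cocycles_eq[OF E E' \<sigma> \<sigma>''(1)])
  qed
qed

text \<open>The first conjunct spells out well-definedness: complements exist and all of them give
  one class in \<open>H2_L\<close>, so the description in \<open>extension_class\<close>
  denotes.\<close>

theorem theorem5p13:
  fixes H :: "('k::field_char_0, 'h::ab_group_add) lie_alg"
    and nabla :: "'h \<Rightarrow> 'h \<Rightarrow> 'h"
    and E :: "('k, 'g::ab_group_add, 'h) lagr_ext"
    and E' :: "('k, 'g2::ab_group_add, 'h) lagr_ext"
  assumes "flat_lie_algebra H nabla"
  shows "(lagrangian_extension_over H nabla E \<longrightarrow>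
            (\<exists>N. lagrangian_complement E N) \<and>
            (\<forall>N. lagrangian_complement E N \<longrightarrow>
               extension_cocycle E N \<in> Z2_L H nabla \<and>
               cohomology_class_L H nabla (extension_cocycle E N) = extension_class H nabla E) \<and>
            extension_class H nabla E \<in> H2_L H nabla) \<and>
         (lagrangian_extension_over H nabla E \<and> lagrangian_extension_over H nabla E' \<longrightarrow>
            (isomorphic_extensions E E' \<longleftrightarrow>
             extension_class H nabla E = extension_class H nabla E'))"
proof (intro conjI impI)
  assume "lagrangian_extension_over H nabla E"
  then interpret E: flat_lagrangian_extension H nabla E by unfold_locales
  obtain \<sigma> where \<sigma>: "lagrangian_section H E \<sigma>" using E.lagrangian_section_ex by blast
  show "\<exists>N. lagrangian_complement E N" using E.lagrangian_complement_range[OF \<sigma>] by blast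
  show "\<forall>N. lagrangian_complement E N \<longrightarrow>
      extension_cocycle E N \<in> Z2_L H nabla \<and>
      cohomology_class_L H nabla (extension_cocycle E N) = extension_class H nabla E"
    using E.extension_cocycle_eq E.lagrangian_section_lift(1) E.section_cocycle_in_Z2_L
      E.extension_class_eq by metis
  show "extension_class H nabla E \<in> H2_L H nabla"
    using E.section_cocycle_in_Z2_L[OF \<sigma>]
    by (simp add: E.extension_class_eq[OF \<sigma>] cohomology_class_L_def H2_L_def quotientI)
next
  assume "lagrangian_extension_over H nabla E \<and> lagrangian_extension_over H nabla E'"
  then show "isomorphic_extensions E E' \<longleftrightarrow> extension_class H nabla E = extension_class H nabla E'"
    by (intro isomorphic_iff_extension_class_eq) (simp_all add: flat_lagrangian_extension_def)
qed

end
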